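(* Let $m,n$ be positive integers and let $\mathcal{S}\in F(m,n,2)$ be an f-diagonal tensor. Then $\mathcal{S}\in S(m,n,2)$ if and only if both of the following hold: (a) $\mathcal{S}(i,i,1)\ge|\mathcal{S}(i,i,2)|$ for $i=1,2,\dots,\min\{m,n\}$; (b) $\mathcal{S}(i,i,1)-\mathcal{S}(i+1,i+1,1)\ge|\mathcal{S}(i,i,2)-\mathcal{S}(i+1,i+1,2)|$ for $i=1,2,\dots,\min\{m,n\}-1$.
   Context: Let $T(m,n,p)$ be the real linear space of $m\times n\times p$ real tensors; $\mathcal{A}(i,j,k)$ denotes the entries of $\mathcal{A}\in T(m,n,p)$ and $A^{(k)}=\mathcal{A}(:,:,k)\in\mathbb{R}^{m\times n}$ its frontal slices, $k=1,\dots,p$. A tensor is f-diagonal if all its frontal slices are (rectangular) diagonal matrices; $F(m,n,p)$ is the set of f-diagonal tensors in $T(m,n,p)$. Kilmer-Martin mapping $G:T(m,n,p)\to F(m,n,p)$. Let $\omega=e^{2\pi\sqrt{-1}/p}$. For $\mathcal{A}\in T(m,n,p)$ and $k=1,\dots,p$ put $\Delta^{(k)}(\mathcal{A})=\sum_{l=1}^p\omega^{(l-1)(k-1)}A^{(l)}\in\mathbb{C}^{m\times n}$, and let $\mathcal{D}(i,i,k)$, $i=1,\dots,\min\{m,n\}$, be the singular values of $\Delta^{(k)}(\mathcal{A})$ in nonincreasing order (counted with multiplicity). Then $\mathcal{S}=G(\mathcal{A})$ is the f-diagonal tensor with $\mathcal{S}(i,i,k)=\frac1p\sum_{l=1}^p\bar\omega^{(k-1)(l-1)}\mathcal{D}(i,i,l)$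 for $i=1,\dots,\min\{m,n\}$, $k=1,\dots,p$ (these numbers are real). A tensor $\mathcal{S}\in F(m,n,p)$ is called s-diagonal if there is some $\mathcal{A}\in T(m,n,p)$ with $G(\mathcal{A})=\mathcal{S}$; $S(m,n,p)$ denotes the set of all s-diagonal tensors in $F(m,n,p)$. Here $p=2$. *)

theory Defs
  imports Complex_Main "HOL-Library.Multiset" "HOL-Computational_Algebra.Polynomial"
    "Jordan_Normal_Form.Schur_Decomposition"
begin

text \<open>A real tensor of size \<open>m \<times> n \<times> p\<close> is the list of its \<open>p\<close> frontal slices, each an
  \<open>m \<times> n\<close> matrix. All indices start at \<open>0\<close>, so the entry usually written
  \<open>\<A>(i, j, k)\<close> with indices starting at \<open>1\<close> is \<open>tensor_entry A (i - 1) (j - 1) (k - 1)\<close>.\<close>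

type_synonym tensor = "real mat list"

definition tensor_entry :: "tensor \<Rightarrow> nat \<Rightarrow> nat \<Rightarrow> nat \<Rightarrow> real" where
  "tensor_entry A i j k = (A ! k) $$ (i, j)"

definition tensors :: "nat \<Rightarrow> nat \<Rightarrow> nat \<Rightarrow> tensor set" where
  "tensors m n p = {A. length A = p \<and> set A \<subseteq> carrier_mat m n}"

definition f_diagonal_tensors :: "nat \<Rightarrow> nat \<Rightarrow> nat \<Rightarrow> tensor set" where
  "f_diagonal_tensors m n p = {S \<in> tensors m n p. \<forall>M \<in> set S. diagonal_mat M}"

text \<open>The square roots of the eigenvalues of \<open>M\<^sup>* M\<close>, counted with (algebraic) multiplicity and
  listed in nonincreasing order. Only the \<open>min m n\<close> largest ones are kept: if \<open>M\<close> has more columns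
  than rows, the others are zeros coming from the kernel of \<open>M\<close>. The eigenvalues are real and
  nonnegative, so \<open>Re\<close> only changes the type.\<close>

definition singular_values :: "complex mat \<Rightarrow> real list" where
  "singular_values M = take (min (dim_row M) (dim_col M))
     (rev (sorted_list_of_multiset
       (image_mset (\<lambda>z. sqrt (Re z)) (proots (char_poly (mat_adjoint M * M))))))"

definition omega :: "nat \<Rightarrow> complex" where
  "omega p = exp (2 * of_real pi * \<i> / of_nat p)"

definition Delta :: "nat \<Rightarrow> nat \<Rightarrow> nat \<Rightarrow> tensor \<Rightarrow> nat \<Rightarrow> complex mat" where
  "Delta m n p A k =
     mat m n (\<lambda>(i, j). \<Sum>l<p. omega p ^ (l * k) * complex_of_real (tensor_entry A i j l))"

text \<open>The Kilmer-Martin mapping. The slices of \<open>A\<close> are real, so \<open>Delta m n p A (p - k)\<close> is the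
  entrywise conjugate of \<open>Delta m n p A k\<close> and has the same singular values; hence the sum below is
  real, and \<open>Re\<close> only changes the type.\<close>

definition kilmer_martin :: "nat \<Rightarrow> nat \<Rightarrow> nat \<Rightarrow> tensor \<Rightarrow> tensor" where
  "kilmer_martin m n p A =
     map (\<lambda>k. mat m n (\<lambda>(i, j). if i = j
       then Re ((1 / of_nat p) *
         (\<Sum>l<p. cnj (omega p) ^ (k * l) * complex_of_real (singular_values (Delta m n p A l) ! i)))
       else 0)) [0..<p]"

definition s_diagonal_tensors :: "nat \<Rightarrow> nat \<Rightarrow> nat \<Rightarrow> tensor set" where
  "s_diagonal_tensors m n p =
     {S \<in> f_diagonal_tensors m n p. \<exists>A \<in> tensors m n p. kilmer_martin m n p A = S}"

end

theory Submission
  imports Defs "HOL-Computational_Algebra.Fundamental_Theorem_Algebra"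
begin

text \<open>For \<open>p = 2\<close> the mapping sends \<open>A\<close> to half the sum and half the difference of the singular
  value sequences of the sum and the difference of the two slices of \<open>A\<close>. Conditions (a) and (b) say
  exactly that the sum and the difference of the two diagonals of \<open>S\<close> are nonnegative and
  nonincreasing, which singular value sequences always are. Conversely, a rectangular diagonal matrix with such a diagonal has that
  diagonal as its singular values, so under (a) and (b) \<open>S\<close> is a fixed point of the mapping.\<close>

lemma mat_adjoint_carrier:
  assumes "M \<in> carrier_mat m n"
  shows "mat_adjoint M \<in> carrier_mat n m"
  using assms by (auto simp: mat_adjoint_def)

lemma index_mat_adjoint:
  assumes "M \<in> carrier_mat m n" "i < n" "j < m"
  shows "mat_adjoint M $$ (i, j) = conjugate (M $$ (j, i))"
  using assms by (auto simp: mat_adjoint_def mat_of_rows_index)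

text \<open>Exchanging the two summations over the entries of \<open>M\<close> proves this
  adjunction, which turns the quadratic form of \<open>mat_adjoint M * M\<close> into a squared
  norm.\<close>

lemma scalar_prod_mat_adjoint:
  fixes M :: "complex mat"
  assumes M: "M \<in> carrier_mat m n" and v: "v \<in> carrier_vec n" and w: "w \<in> carrier_vec m"
  shows "(mat_adjoint M *\<^sub>v w) \<bullet>c v = w \<bullet>c (M *\<^sub>v v)"
proof -
  note A = mat_adjoint_carrier[OF M]
  have "(mat_adjoint M *\<^sub>v w) \<bullet>c v
      = (\<Sum>i<n. (\<Sum>j<m. cnj (M $$ (j, i)) * w $ j) * cnj (v $ i))"
    using M v w A
    by (auto simp: scalar_prod_def index_mat_adjoint[OF M] atLeast0LessThan intro!: sum.cong)
  also have "\<dots> = (\<Sum>j<m. \<Sum>i<n. w $ j * (cnj (M $$ (j, i)) * cnj (v $ i)))"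
    unfolding sum_distrib_right by (subst sum.swap) (simp add: mult_ac)
  also have "\<dots> = w \<bullet>c (M *\<^sub>v v)"
    using M v w
    by (auto simp: scalar_prod_def atLeast0LessThan sum_distrib_left intro!: sum.cong)
  finally show ?thesis .
qed

text \<open>Pairing the eigenvalue equation with an eigenvector \<open>v\<close> equates
  \<open>z\<close> times the squared norm of \<open>v\<close> with the squared norm of
  \<open>M *\<^sub>v v\<close>.\<close>

lemma eigenvalue_adjoint_mult_nonneg:
  fixes M :: "complex mat"
  assumes M: "M \<in> carrier_mat m n" and "eigenvalue (mat_adjoint M * M) z"
  shows "0 \<le> Re z"
proof -
  note A = mat_adjoint_carrier[OF M]
  obtain v where v: "v \<in> carrier_vec n" "v \<noteq> 0\<^sub>v n" and e: "(mat_adjoint M * M) *\<^sub>v v = z \<cdot>\<^sub>v v"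
    using assms A by (auto simp: eigenvalue_def eigenvector_def)
  define w where "w = M *\<^sub>v v"
  have w: "w \<in> carrier_vec m" using M v by (simp add: w_def)
  have "z * (v \<bullet>c v) = (mat_adjoint M *\<^sub>v w) \<bullet>c v"
    using e A M v by (simp add: w_def flip: assoc_mult_mat_vec)
  also have "\<dots> = w \<bullet>c w"
    using scalar_prod_mat_adjoint[OF M v(1) w] by (simp add: w_def)
  \<comment> \<open>In the order on the complex numbers, being at least 0 means being real and
    nonnegative.\<close>
  finally have "z * (v \<bullet>c v) \<ge> 0" by auto
  moreover have "v \<bullet>c v > 0" using v by simp
  ultimately show ?thesis
    by (auto simp: less_eq_complex_def less_complex_def zero_le_mult_iff)
qed

text \<open>The characteristic polynomial has degree \<open>n\<close> and splits over the complex
  numbers, so there are \<open>n\<close> roots with multiplicity, of which \<open>min m n\<close>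
  are kept.\<close>

lemma length_singular_values:
  assumes M: "M \<in> carrier_mat m n"
  shows "length (singular_values M) = min m n"
proof -
  have "mat_adjoint M * M \<in> carrier_mat n n"
    using M mat_adjoint_carrier[OF M] by auto
  then have "size (proots (char_poly (mat_adjoint M * M))) = n"
    by (simp add: size_proots_complex degree_monic_char_poly)
  moreover have "length (sorted_list_of_multiset X) = size X" for X :: "real multiset"
    by (simp flip: size_mset)
  ultimately show ?thesis
    using M by (simp add: singular_values_def)
qed

lemma sorted_singular_values: "sorted_wrt (\<ge>) (singular_values M)"
  unfolding singular_values_def by (intro sorted_wrt_take) (simp add: sorted_wrt_rev)

text \<open>As \<open>sqrt\<close> is negative at negative reals, the sign has to come from the
  eigenvalues of \<open>mat_adjoint M * M\<close>.\<close>

lemma singular_values_nonneg: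
  assumes M: "M \<in> carrier_mat m n" and x: "x \<in> set (singular_values M)"
  shows "0 \<le> x"
proof -
  have C: "mat_adjoint M * M \<in> carrier_mat n n"
    using M mat_adjoint_carrier[OF M] by auto
  from x obtain z where z: "z \<in># proots (char_poly (mat_adjoint M * M))" "x = sqrt (Re z)"
    by (auto simp: singular_values_def dest!: in_set_takeD)
  have "char_poly (mat_adjoint M * M) \<noteq> 0"
    using degree_monic_char_poly[OF C] by auto
  then have "eigenvalue (mat_adjoint M * M) z"
    using z C by (simp add: eigenvalue_root_char_poly)
  then show ?thesis
    using z eigenvalue_adjoint_mult_nonneg[OF M] by simp
qed

text \<open>Root multisets add up over nonzero products. This reads off the spectrum of a triangular
  matrix with multiplicities.\<close>

lemma proots_linear_factors:
  fixes as :: "'a :: idom list"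
  shows "proots (\<Prod>a\<leftarrow>as. [:- a, 1:]) = mset as"
proof (induction as)
  case (Cons a as)
  have "(\<Prod>a\<leftarrow>as. [:- a, 1:]) \<noteq> 0" by (auto simp: prod_list_zero_iff)
  then show ?case using Cons by (simp add: proots_mult del: mult_pCons_left)
qed simp

text \<open>The matrix \<open>mat_adjoint M * M\<close> is diagonal, with the squares of the
  \<open>d i\<close> followed by zeros if \<open>n > m\<close>. Their roots are already in
  nonincreasing order, so sorting does not permute them and truncation removes just the
  padding.\<close>

lemma singular_values_diagonal:
  fixes M :: "complex mat" and d :: "nat \<Rightarrow> real"
  assumes M: "M \<in> carrier_mat m n" and diag: "diagonal_mat M"
    and d: "\<And>i. i < min m n \<Longrightarrow> M $$ (i, i) = complex_of_real (d i)"
    and nonneg: "\<And>i. i < min m n \<Longrightarrow> 0 \<le> d i"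
    and decr: "\<And>i. i + 1 < min m n \<Longrightarrow> d (i + 1) \<le> d i"
  shows "singular_values M = map d [0..<min m n]"
proof -
  define C where "C = mat_adjoint M * M"
  \<comment> \<open>For \<open>i < n\<close>, the bound \<open>i < m\<close> is the same as
    \<open>i < min m n\<close>; the columns of \<open>M\<close> from \<open>m\<close> on
    vanish.\<close>
  define f where "f i = (if i < m then d i else 0)" for i
  note A = mat_adjoint_carrier[OF M]
  have C: "C \<in> carrier_mat n n" using A M by (simp add: C_def)
  have entry: "C $$ (i, j) = (if i = j then complex_of_real ((f i)\<^sup>2) else 0)"
    if "i < n" "j < n" for i j
  proof -
    have "C $$ (i, j) = (\<Sum>k<m. cnj (M $$ (k, i)) * M $$ (k, j))"
      using that A M
      by (auto simp: C_def scalar_prod_def index_mat_adjoint[OF M] atLeast0LessThan intro!: sum.cong)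
    \<comment> \<open>Column \<open>i\<close> of \<open>M\<close> can be nonzero only in row
      \<open>i\<close>. If \<open>i \<ge> m\<close>, no \<open>k\<close> matches and the sum is 0,
      as \<open>f i\<close> requires.\<close>
    also have "\<dots> = (\<Sum>k<m. if k = i then if i = j then complex_of_real ((d i)\<^sup>2) else 0 else 0)"
      using that M diag d by (intro sum.cong) (auto simp: diagonal_mat_def power2_eq_square)
    finally show ?thesis by (simp add: f_def)
  qed
  have "upper_triangular C" using C entry by (auto simp: upper_triangular_def)
  then have "char_poly C = (\<Prod>a\<leftarrow>diag_mat C. [:- a, 1:])"
    using char_poly_upper_triangular C by blast
  then have "proots (char_poly C) = mset (diag_mat C)"
    by (simp add: proots_linear_factors)
  also have "diag_mat C = map (\<lambda>i. complex_of_real ((f i)\<^sup>2)) [0..<n]"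
    using C entry by (auto simp: diag_mat_def)
  finally have "image_mset (\<lambda>z. sqrt (Re z)) (proots (char_poly C)) =
      mset (map (\<lambda>i. sqrt ((f i)\<^sup>2)) [0..<n])"
    by (simp add: image_mset.compositionality o_def)
  also have "map (\<lambda>i. sqrt ((f i)\<^sup>2)) [0..<n] = map f [0..<n]"
    using nonneg by (auto simp: f_def)
  finally have eq: "sorted_list_of_multiset
      (image_mset (\<lambda>z. sqrt (Re z)) (proots (char_poly C))) = sort (map f [0..<n])"
    by (simp only: sorted_list_of_multiset_mset)
  \<comment> \<open>At the passage from \<open>d\<close> to the padding, \<open>nonneg\<close> takes
    over from \<open>decr\<close>.\<close>
  have "f (Suc i) \<le> f i" if "Suc i < n" for i
    using that nonneg[of i] decr[of i] by (auto simp: f_def)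
  then have "sorted_wrt (\<ge>) (map f [0..<n])"
    by (subst sorted_wrt_iff_nth_Suc_transp) (auto intro: transpI)
  \<comment> \<open>Sorting is ascending, so it reverses the list; the \<open>rev\<close> in
    \<open>singular_values\<close> undoes this.\<close>
  then have "sort (map f [0..<n]) = rev (map f [0..<n])"
    by (intro properties_for_sort) (simp_all only: mset_rev sorted_wrt_rev)
  then have "singular_values M = take (min m n) (map f [0..<n])"
    using M eq by (simp add: singular_values_def C_def)
  then show ?thesis
    by (simp add: take_map f_def)
qed

lemma omega_2: "omega 2 = -1"
  by (simp add: omega_def)

lemma sum_lessThan_2: "(\<Sum>l<2. f l) = f 0 + f (1 :: nat)"
  by (simp add: numeral_2_eq_2)

lemma tensor_entry_kilmer_martin_2:
  assumes "i < min m n"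
  shows "tensor_entry (kilmer_martin m n 2 A) i i 0 =
      (singular_values (Delta m n 2 A 0) ! i + singular_values (Delta m n 2 A 1) ! i) / 2"
    and "tensor_entry (kilmer_martin m n 2 A) i i 1 =
      (singular_values (Delta m n 2 A 0) ! i - singular_values (Delta m n 2 A 1) ! i) / 2"
  using assms
  by (simp_all add: tensor_entry_def kilmer_martin_def omega_2 sum_lessThan_2 upt_rec)

text \<open>Each matrix \<open>Delta m n 2 S k\<close> is diagonal and, by the hypotheses, its
  diagonal is its own list of singular values. The mapping thus only applies the Fourier transform
  and then its inverse.\<close>

lemma kilmer_martin_fixed_point:
  assumes S: "S \<in> f_diagonal_tensors m n 2"
    and a: "\<And>i. i < min m n \<Longrightarrow> tensor_entry S i i 0 \<ge> \<bar>tensor_entry S i i 1\<bar>"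
    and b: "\<And>i. i + 1 < min m n \<Longrightarrow>
       tensor_entry S i i 0 - tensor_entry S (i + 1) (i + 1) 0
         \<ge> \<bar>tensor_entry S i i 1 - tensor_entry S (i + 1) (i + 1) 1\<bar>"
  shows "kilmer_martin m n 2 S = S"
proof -
  have len: "length S = 2" and car: "S ! k \<in> carrier_mat m n" "diagonal_mat (S ! k)" if "k < 2" for k
    using S that by (auto simp: f_diagonal_tensors_def tensors_def)
  have off: "S ! k $$ (i, j) = 0" if "k < 2" "i < m" "j < n" "i \<noteq> j" for i j k
    using car[OF that(1)] that by (auto simp: diagonal_mat_def)
  \<comment> \<open>The sign \<open>(-1) ^ k\<close> treats the sum of the slices
    (\<open>k = 0\<close>) and their difference (\<open>k = 1\<close>) at once.\<close>
  have sv: "singular_values (Delta m n 2 S k) =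
      map (\<lambda>i. tensor_entry S i i 0 + (-1) ^ k * tensor_entry S i i 1) [0..<min m n]" if "k < 2" for k
  proof (rule singular_values_diagonal)
    show "Delta m n 2 S k \<in> carrier_mat m n" by (simp add: Delta_def)
    show "diagonal_mat (Delta m n 2 S k)"
      by (auto simp: diagonal_mat_def Delta_def tensor_entry_def off)
    show "Delta m n 2 S k $$ (i, i) =
        complex_of_real (tensor_entry S i i 0 + (-1) ^ k * tensor_entry S i i 1)"
      if "i < min m n" for i
      using that by (simp add: Delta_def omega_2 sum_lessThan_2)
    \<comment> \<open>The absolute values in \<open>a\<close> and \<open>b\<close> bound both signs,
      one for each \<open>k\<close>.\<close>
    have k: "k = 0 \<or> k = 1" using \<open>k < 2\<close> by auto
    show "0 \<le> tensor_entry S i i 0 + (-1) ^ k * tensor_entry S i i 1" if "i < min m n" for i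
      using a[OF that] k by auto
    show "tensor_entry S (i + 1) (i + 1) 0 + (-1) ^ k * tensor_entry S (i + 1) (i + 1) 1
        \<le> tensor_entry S i i 0 + (-1) ^ k * tensor_entry S i i 1" if "i + 1 < min m n" for i
      using b[OF that] k by auto
  qed
  show ?thesis
  proof (rule nth_equalityI)
    show "length (kilmer_martin m n 2 S) = length S"
      using len[of 0] by (simp add: kilmer_martin_def)
    fix k assume "k < length (kilmer_martin m n 2 S)"
    then have k: "k < 2" by (simp add: kilmer_martin_def)
    show "kilmer_martin m n 2 S ! k = S ! k"
    proof (rule eq_matI)
      fix i j assume "i < dim_row (S ! k)" "j < dim_col (S ! k)"
      then have ij: "i < m" "j < n" using car[OF k] by auto
      show "kilmer_martin m n 2 S ! k $$ (i, j) = S ! k $$ (i, j)"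
      proof (cases "i = j")
        case True
        with ij have i: "i < min m n" by simp
        have "k = 0 \<or> k = 1" using k by auto
        then have "tensor_entry (kilmer_martin m n 2 S) i i k = tensor_entry S i i k"
          using i tensor_entry_kilmer_martin_2[OF i, of S] by (auto simp: sv)
        then show ?thesis using True by (simp add: tensor_entry_def)
      next
        case False
        then show ?thesis using ij k off by (simp add: kilmer_martin_def del: upt_Suc)
      qed
    qed (use car[OF k] k in \<open>auto simp: kilmer_martin_def simp del: upt_Suc\<close>)
  qed
qed

theorem theorem7p1:
  fixes m n :: nat and S :: tensor
  assumes "m > 0" and "n > 0" and "S \<in> f_diagonal_tensors m n 2"
  shows "S \<in> s_diagonal_tensors m n 2 \<longleftrightarrow>
    (\<forall>i < min m n. tensor_entry S i i 0 \<ge> \<bar>tensor_entry S i i 1\<bar>) \<and>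
    (\<forall>i. i + 1 < min m n \<longrightarrow>
       tensor_entry S i i 0 - tensor_entry S (i + 1) (i + 1) 0
         \<ge> \<bar>tensor_entry S i i 1 - tensor_entry S (i + 1) (i + 1) 1\<bar>)"
    (is "_ \<longleftrightarrow> ?a \<and> ?b")
proof
  assume "S \<in> s_diagonal_tensors m n 2"
  then obtain A where A: "S = kilmer_martin m n 2 A"
    by (auto simp: s_diagonal_tensors_def)
  define \<sigma> where "\<sigma> k = singular_values (Delta m n 2 A k)" for k
  have D: "Delta m n 2 A k \<in> carrier_mat m n" for k by (simp add: Delta_def)
  have len: "length (\<sigma> k) = min m n" for k
    using length_singular_values[OF D] by (simp add: \<sigma>_def)
  \<comment> \<open>The length guarantees that the index picks an actual element of the
    list.\<close>
  have nonneg: "0 \<le> \<sigma> k ! i" if "i < min m n" for i k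
    using that len[of k] singular_values_nonneg[OF D] by (metis \<sigma>_def nth_mem)
  have decr: "\<sigma> k ! (i + 1) \<le> \<sigma> k ! i" if "i + 1 < min m n" for i k
    using sorted_singular_values[of "Delta m n 2 A k"] that len[of k]
    by (simp add: sorted_wrt_iff_nth_less \<sigma>_def)
  have S: "tensor_entry S i i 0 = (\<sigma> 0 ! i + \<sigma> 1 ! i) / 2"
      "tensor_entry S i i 1 = (\<sigma> 0 ! i - \<sigma> 1 ! i) / 2" if "i < min m n" for i
    using tensor_entry_kilmer_martin_2[OF that, of A] by (simp_all add: A \<sigma>_def)
  have ?a
  proof (intro allI impI)
    fix i assume i: "i < min m n"
    show "tensor_entry S i i 0 \<ge> \<bar>tensor_entry S i i 1\<bar>"
      \<comment> \<open>For reals, \<open>\<bar>x - y\<bar> \<le> x + y\<close> holds if and only if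
        \<open>x\<close> and \<open>y\<close> are both nonnegative.\<close>
      using nonneg[OF i, of 0] nonneg[OF i, of 1] unfolding S[OF i] by argo
  qed
  moreover have ?b
  proof (intro allI impI)
    fix i assume i: "i + 1 < min m n"
    then have "i < min m n" by simp
    then show "tensor_entry S i i 0 - tensor_entry S (i + 1) (i + 1) 0
        \<ge> \<bar>tensor_entry S i i 1 - tensor_entry S (i + 1) (i + 1) 1\<bar>"
      \<comment> \<open>The same inequality, now with \<open>x\<close> and \<open>y\<close> the
        drops of \<open>\<sigma> 0\<close> and \<open>\<sigma> 1\<close> from \<open>i\<close> to
        \<open>i + 1\<close>.\<close>
      using decr[OF i, of 0] decr[OF i, of 1]
      unfolding S[OF i] S[OF \<open>i < min m n\<close>] by argo
  qed
  ultimately show "?a \<and> ?b" ..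
next
  assume "?a \<and> ?b"
  \<comment> \<open>The witness for the preimage of \<open>S\<close> is \<open>S\<close>
    itself.\<close>
  then have "kilmer_martin m n 2 S = S"
    using assms(3) by (intro kilmer_martin_fixed_point) auto
  then show "S \<in> s_diagonal_tensors m n 2"
    using assms(3) by (auto simp: s_diagonal_tensors_def f_diagonal_tensors_def)
qed

end
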